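(* Let $t$ be a positive integer. If $G$ is a graph, $\mathcal{F}$ is a set of graphs, and $\mathcal{F}$ has the EP property (with associated function $f_{\mathcal{F}}$), then \[\iota(G,\mathcal{F}) - f_\mathcal{F}(t) \leq \iota(G, t\mathcal{F}) \leq \iota(G, \mathcal{F}).\]
   Context: Graphs are finite, simple and undirected, with non-empty vertex set (except that deleting vertices may yield the null graph). For a graph $G$ and $D \subseteq V(G)$, $N[D]$ denotes the closed neighbourhood of $D$ in $G$. For a set $\mathcal{F}$ of graphs, an $\mathcal{F}$-graph is a graph isomorphic to a member of $\mathcal{F}$. A graph contains an $\mathcal{F}$-graph if it has a (not necessarily induced) subgraph that is an $\mathcal{F}$-graph. A set $D \subseteq V(G)$ is an $\mathcal{F}$-isolating set of $G$ if $G - N[D]$ contains no $\mathcal{F}$-graph, and $\iota(G,\mathcal{F})$ denotes the size of a smallest $\mathcal{F}$-isolating set of $G$. For a positive integer $t$, \[t\mathcal{F} = \{F_1 \cup \dots \cup F_t \colon F_1, \dots, F_t \mbox{ are pairwise vertex-disjoint } \mathcal{F}\mbox{-graphs}\}.\] $\mathbb{N}$ is the set of positive integers. $\mathcal{F}$ has the EP (Erd\H{o}s--P\'{o}sa) property if there exists a function $f_{\mathcal{F}} \colon \mathbb{N} \rightarrow \mathbb{N}$ such that for every $t \in \mathbb{N}$ and every graph $G$ containing no $t\mathcal{F}$-graph, $V(G)$ has a subset $S$ such that $|S| \leq f_{\mathcal{F}}(t)$ and $G - S$ contains no $\mathcal{F}$-graph; $f_{\mathcal{F}}$ denotes such a function.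 *)

theory Defs
  imports
    "Graph_Theory.Digraph_Isomorphism"
    "HOL-Library.Disjoint_Sets"
    "HOL-Library.Infinite_Typeclass"
begin

text \<open>
  An undirected graph is a symmetric, loop-free digraph whose arcs are pairs of vertices
  (\<open>pair_graph\<close>); finiteness is part of that locale. An edge \<open>{u, v}\<close> is the pair of arcs
  \<open>(u, v)\<close> and \<open>(v, u)\<close>. Predicates that are also applied to the results of
  vertex deletion take an arbitrary \<open>pre_digraph\<close>.
\<close>

definition nonnull_graph :: "'a pair_pre_digraph \<Rightarrow> bool" where
  "nonnull_graph G \<longleftrightarrow> pair_graph G \<and> pverts G \<noteq> {}"

definition closed_nbhd :: "'a pair_pre_digraph \<Rightarrow> 'a set \<Rightarrow> 'a set" where
  "closed_nbhd G D = D \<union> {v. \<exists>u\<in>D. (u, v) \<in> parcs G}"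

definition del_verts :: "('a, 'b) pre_digraph \<Rightarrow> 'a set \<Rightarrow> ('a, 'b) pre_digraph" where
  "del_verts G S = G \<restriction> (verts G - S)"

definition family_graph :: "'u pair_pre_digraph set \<Rightarrow> ('a, 'b) pre_digraph \<Rightarrow> bool" where
  "family_graph \<F> H \<longleftrightarrow> (\<exists>M\<in>\<F>. digraph_iso (with_proj M) H)"

text \<open>
  The subgraph \<open>H\<close> below need not be required to be symmetric: it is isomorphic to a member of
  \<open>\<F>\<close>, so it is an undirected graph whenever the members of \<open>\<F>\<close> are.
\<close>

definition contains_family_graph :: "('a, 'b) pre_digraph \<Rightarrow> 'u pair_pre_digraph set \<Rightarrow> bool" where
  "contains_family_graph G \<F> \<longleftrightarrow> (\<exists>H. subgraph H G \<and> family_graph \<F> H)"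

definition isolating :: "'a pair_pre_digraph \<Rightarrow> 'u pair_pre_digraph set \<Rightarrow> 'a set \<Rightarrow> bool" where
  "isolating G \<F> D \<longleftrightarrow> D \<subseteq> pverts G \<and>
     \<not> contains_family_graph (del_verts (with_proj G) (closed_nbhd G D)) \<F>"

text \<open>
  The minimum is attained for a finite graph \<open>G\<close> if no member of \<open>\<F>\<close> is null,
  since then the whole vertex set is isolating.
\<close>

definition iota :: "'a pair_pre_digraph \<Rightarrow> 'u pair_pre_digraph set \<Rightarrow> nat" where
  "iota G \<F> = (LEAST k. \<exists>D. isolating G \<F> D \<and> card D = k)"

text \<open>
  The vertices of the graphs in a family come from an infinite type. Such a type accommodates every
  finite graph up to isomorphism, and any number of pairwise disjoint copies; the next two notions,
  which range over all graphs, would be wrong over a finite type.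
\<close>

definition copies :: "nat \<Rightarrow> 'u::infinite pair_pre_digraph set \<Rightarrow> 'u pair_pre_digraph set" where
  "copies t \<F> =
     {\<lparr>pverts = (\<Union>i\<in>{1..t}. pverts (Fs i)), parcs = (\<Union>i\<in>{1..t}. parcs (Fs i))\<rparr> | Fs.
        (\<forall>i\<in>{1..t}. family_graph \<F> (with_proj (Fs i))) \<and>
        disjoint_family_on (\<lambda>i. pverts (Fs i)) {1..t}}"

text \<open>\<open>\<F>\<close> has the Erdos--Posa property, with associated function \<open>f\<close> on the positive integers.\<close>

definition EP_property :: "'u::infinite pair_pre_digraph set \<Rightarrow> (nat \<Rightarrow> nat) \<Rightarrow> bool" where
  "EP_property \<F> f \<longleftrightarrow> f \<in> {1..} \<rightarrow> {1..} \<and>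
     (\<forall>t\<ge>1. \<forall>G :: 'u pair_pre_digraph.
        nonnull_graph G \<and> \<not> contains_family_graph (with_proj G) (copies t \<F>) \<longrightarrow>
        (\<exists>S\<subseteq>pverts G. card S \<le> f t \<and> \<not> contains_family_graph (del_verts (with_proj G) S) \<F>))"

end

theory Submission
  imports Defs
begin

text \<open>
  For the upper bound, every \<open>t\<F>\<close>-graph contains an \<open>\<F>\<close>-graph, namely its first component
  (\<open>copies_member_contains\<close>, which uses \<open>t \<ge> 1\<close>), so an \<open>\<F>\<close>-isolating set is also
  \<open>t\<F>\<close>-isolating.

  For the lower bound, take a smallest \<open>t\<F>\<close>-isolating set \<open>D\<close> of \<open>G\<close>. The graph \<open>H = G - N[D]\<close>
  contains no \<open>t\<F>\<close>-graph, so the Erdos--Posa property gives a set \<open>S\<close> of at most \<open>f t\<close> vertices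
  of \<open>H\<close> such that \<open>H - S\<close> contains no \<open>\<F>\<close>-graph. Since \<open>N[D \<union> S]\<close> includes both \<open>N[D]\<close> and
  \<open>S\<close>, the set \<open>D \<union> S\<close> is \<open>\<F>\<close>-isolating, and it has at most \<open>\<iota>(G, t\<F>) + f t\<close> elements.

  The Erdos--Posa property speaks of graphs over the vertex type of the family, while \<open>G\<close> lives
  over another type. A finite graph has an isomorphic copy over any infinite type, and containment
  of family members is a matter of injective, arc-preserving maps (\<open>contains_family_graph_iff\<close>), so
  it can be carried over to the copy and back by composing such maps
  (\<open>EP_property_hitting_set\<close>).
\<close>

section \<open>Subgraph containment as embedding\<close>

definition embedding :: "('a \<Rightarrow> 'b) \<Rightarrow> 'a pair_pre_digraph \<Rightarrow> 'b pair_pre_digraph \<Rightarrow> bool" where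
  "embedding \<phi> A B \<longleftrightarrow>
     inj_on \<phi> (pverts A) \<and> \<phi> ` pverts A \<subseteq> pverts B \<and> map_prod \<phi> \<phi> ` parcs A \<subseteq> parcs B"

lemma embedding_comp:
  assumes "embedding \<phi> A B" "embedding \<psi> B C"
  shows "embedding (\<psi> \<circ> \<phi>) A C"
proof -
  have "inj_on (\<psi> \<circ> \<phi>) (pverts A)"
    using assms by (auto simp: embedding_def intro: comp_inj_on inj_on_subset)
  moreover have "\<psi> (\<phi> v) \<in> pverts C" if "v \<in> pverts A" for v
    using that assms by (simp add: embedding_def image_subset_iff)
  moreover have "(\<psi> (\<phi> u), \<psi> (\<phi> v)) \<in> parcs C" if "(u, v) \<in> parcs A" for u v
    using that assms by (force simp: embedding_def image_subset_iff)
  ultimately show ?thesis by (auto simp: embedding_def)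
qed

text \<open>
  The subgraph in the definition of containment is the image of the embedding; its arcs are pairs
  with the projections as endpoints, so an isomorphism onto it is determined by its vertex map.
\<close>

lemma contains_family_graph_iff:
  assumes "pair_wf_digraph P"
  shows "contains_family_graph (with_proj P) \<F> \<longleftrightarrow>
    (\<exists>M\<in>\<F>. pair_wf_digraph M \<and> (\<exists>\<phi>. embedding \<phi> M P))"
proof
  assume "contains_family_graph (with_proj P) \<F>"
  then obtain H M h where sub: "subgraph H (with_proj P)" and M: "M \<in> \<F>"
    and iso: "pre_digraph.digraph_isomorphism (with_proj M) h" and H: "H = app_iso h (with_proj M)"
    unfolding contains_family_graph_def family_graph_def digraph_iso_def by blast
  have wf: "pair_wf_digraph M"
    using iso by (simp add: pre_digraph.digraph_isomorphism_def wf_digraph_wp_iff)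
  have "arcs_ends H \<subseteq> parcs P"
    using arcs_ends_mono[OF sub] by simp
  moreover have "arcs_ends H = map_prod (iso_verts h) (iso_verts h) ` parcs M"
    using wf_digraph.arcs_ends_app_iso_eq[OF _ iso] wf
    by (simp add: H wf_digraph_wp_iff map_prod_def)
  ultimately have "embedding (iso_verts h) M P"
    using iso sub by (auto simp: embedding_def H subgraph_def pre_digraph.digraph_isomorphism_def)
  with M wf show "\<exists>M\<in>\<F>. pair_wf_digraph M \<and> (\<exists>\<phi>. embedding \<phi> M P)" by blast
next
  assume "\<exists>M\<in>\<F>. pair_wf_digraph M \<and> (\<exists>\<phi>. embedding \<phi> M P)"
  then obtain M \<phi> where M: "M \<in> \<F>" and wf: "pair_wf_digraph M" and emb: "embedding \<phi> M P"
    by blast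
  interpret M: pair_wf_digraph M by (rule wf)
  define h where "h = \<lparr>iso_verts = \<phi>, iso_arcs = map_prod \<phi> \<phi>,
    iso_head = (snd :: 'a \<times> 'a \<Rightarrow> 'a), iso_tail = fst\<rparr>"
  have "parcs M \<subseteq> pverts M \<times> pverts M"
    by (auto dest: M.in_arcsD1 M.in_arcsD2)
  then have "inj_on (map_prod \<phi> \<phi>) (parcs M)"
    using emb by (auto simp: embedding_def intro: inj_on_subset[OF map_prod_inj_on])
  then have iso: "pre_digraph.digraph_isomorphism (with_proj M) h"
    using emb wf
    by (auto simp: pre_digraph.digraph_isomorphism_def h_def embedding_def wf_digraph_wp_iff)
  have "wf_digraph (app_iso h (with_proj M))"
    using wf iso by (auto intro: wf_digraph.wf_digraphI_app_iso simp: wf_digraph_wp_iff)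
  then have "subgraph (app_iso h (with_proj M)) (with_proj P)"
    using emb assms
    by (auto simp: subgraph_def embedding_def h_def compatible_def wf_digraph_wp_iff)
  then show "contains_family_graph (with_proj P) \<F>"
    using M iso unfolding contains_family_graph_def family_graph_def digraph_iso_def by blast
qed

lemma contains_family_graph_mono:
  assumes "embedding \<phi> P Q" "pair_wf_digraph P" "pair_wf_digraph Q"
    and "contains_family_graph (with_proj P) \<F>"
  shows "contains_family_graph (with_proj Q) \<F>"
  using assms(1,4)
  unfolding contains_family_graph_iff[OF assms(2)] contains_family_graph_iff[OF assms(3)]
  by (blast intro: embedding_comp)

lemma not_contains_family_graph_null:
  assumes "pair_wf_digraph P" "pverts P = {}" "\<forall>M\<in>\<F>. nonnull_graph M"
  shows "\<not> contains_family_graph (with_proj P) \<F>"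
  using assms(2,3) unfolding contains_family_graph_iff[OF assms(1)]
  by (auto simp: embedding_def nonnull_graph_def)

section \<open>Vertex deletion and isomorphic copies\<close>

definition pair_del_verts :: "'a pair_pre_digraph \<Rightarrow> 'a set \<Rightarrow> 'a pair_pre_digraph" where
  "pair_del_verts P S =
     \<lparr>pverts = pverts P - S, parcs = parcs P \<inter> (pverts P - S) \<times> (pverts P - S)\<rparr>"

lemma del_verts_with_proj: "del_verts (with_proj P) S = with_proj (pair_del_verts P S)"
  by (auto simp: del_verts_def induce_subgraph_def with_proj_def pair_del_verts_def)

lemma pair_graph_iff:
  "pair_graph P \<longleftrightarrow> finite (pverts P) \<and> parcs P \<subseteq> pverts P \<times> pverts P \<and> sym (parcs P) \<and> irrefl (parcs P)"
proof
  assume "pair_graph P"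
  then interpret pair_graph P .
  show "finite (pverts P) \<and> parcs P \<subseteq> pverts P \<times> pverts P \<and> sym (parcs P) \<and> irrefl (parcs P)"
    using in_arcsD1 in_arcsD2 pair_finite_verts arcs_symmetric no_loops'[of a a for a]
    by (auto simp: sym_def irrefl_def)
next
  assume *: "finite (pverts P) \<and> parcs P \<subseteq> pverts P \<times> pverts P \<and> sym (parcs P) \<and> irrefl (parcs P)"
  then have "finite (parcs P)" by (auto intro: finite_subset)
  with * show "pair_graph P"
    by unfold_locales (auto simp: symmetric_def irrefl_def)
qed

lemma pair_graph_imp_wf: "pair_graph P \<Longrightarrow> pair_wf_digraph P"
  by (simp add: pair_graph_def pair_digraph_def pair_fin_digraph_def)

lemma pair_graph_pair_del_verts: "pair_graph P \<Longrightarrow> pair_graph (pair_del_verts P S)"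
  by (auto simp: pair_graph_iff pair_del_verts_def sym_def irrefl_def)

lemma finite_graph_copy:
  fixes H :: "'v pair_pre_digraph"
  assumes "pair_graph H"
  obtains H' :: "'u::infinite pair_pre_digraph" and \<psi> \<psi>'
  where "pair_graph H'" "embedding \<psi> H H'" "embedding \<psi>' H' H" "\<psi> ` pverts H = pverts H'"
proof -
  have H: "finite (pverts H)" "parcs H \<subseteq> pverts H \<times> pverts H" "sym (parcs H)" "irrefl (parcs H)"
    using assms by (auto simp: pair_graph_iff)
  obtain B :: "'u set" where "finite B" "card B = card (pverts H)"
    using infinite_arbitrarily_large[OF infinite_UNIV] by blast
  then obtain \<psi> where bij: "bij_betw \<psi> (pverts H) B"
    using H(1) finite_same_card_bij by metis
  then have inj: "inj_on \<psi> (pverts H)" by (simp add: bij_betw_def)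
  define H' where "H' = \<lparr>pverts = \<psi> ` pverts H, parcs = map_prod \<psi> \<psi> ` parcs H\<rparr>"
  show thesis
  proof
    show "pair_graph H'"
      using H inj unfolding pair_graph_iff H'_def sym_def irrefl_def
      by (fastforce dest: inj_onD)
    show "embedding \<psi> H H'"
      using inj by (auto simp: embedding_def H'_def)
    have "map_prod (inv_into (pverts H) \<psi>) (inv_into (pverts H) \<psi>) ` map_prod \<psi> \<psi> ` parcs H
        \<subseteq> parcs H"
      using H(2) inj by (auto simp: subset_iff)
    then show "embedding (inv_into (pverts H) \<psi>) H' H"
      using inj by (auto simp: embedding_def H'_def intro: inj_on_inv_into)
    show "\<psi> ` pverts H = pverts H'" by (simp add: H'_def)
  qed
qed

text \<open>
  The Erdos--Posa property over an arbitrary vertex type. Members of the family have a vertex, so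
  the null graph, to which the property does not apply, is hit by the empty set.
\<close>

lemma EP_property_hitting_set:
  fixes \<F> :: "'u::infinite pair_pre_digraph set" and H :: "'v pair_pre_digraph"
  assumes EP: "EP_property \<F> f" and "t \<ge> 1" and nonnull: "\<forall>M\<in>\<F>. nonnull_graph M"
    and H: "pair_graph H" and no_copies: "\<not> contains_family_graph (with_proj H) (copies t \<F>)"
  obtains S where "S \<subseteq> pverts H" "card S \<le> f t"
    "\<not> contains_family_graph (del_verts (with_proj H) S) \<F>"
proof (cases "pverts H = {}")
  case True
  then have "\<not> contains_family_graph (del_verts (with_proj H) {}) \<F>"
    using nonnull H unfolding del_verts_with_proj
    by (intro not_contains_family_graph_null pair_graph_imp_wf pair_graph_pair_del_verts)
      (auto simp: pair_del_verts_def)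
  then show thesis using that[of "{}"] by simp
next
  case False
  obtain H' :: "'u pair_pre_digraph" and \<psi> \<psi>' where H': "pair_graph H'"
    and \<psi>: "embedding \<psi> H H'" and \<psi>': "embedding \<psi>' H' H" and img: "\<psi> ` pverts H = pverts H'"
    using finite_graph_copy[OF H] .
  have "\<not> contains_family_graph (with_proj H') (copies t \<F>)"
    using no_copies
      contains_family_graph_mono[OF \<psi>' pair_graph_imp_wf[OF H'] pair_graph_imp_wf[OF H]]
    by (rule contrapos_nn)
  moreover have "nonnull_graph H'"
    using H' img False by (auto simp: nonnull_graph_def)
  ultimately obtain S' where S': "S' \<subseteq> pverts H'" "card S' \<le> f t"
    and none: "\<not> contains_family_graph (with_proj (pair_del_verts H' S')) \<F>"
    using EP \<open>t \<ge> 1\<close> unfolding EP_property_def del_verts_with_proj by blast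
  define S where "S = {v \<in> pverts H. \<psi> v \<in> S'}"
  have "finite S'" using S' H' finite_subset by (auto simp: pair_graph_iff)
  moreover have "inj_on \<psi> S"
    using \<psi> by (auto simp: embedding_def S_def intro: inj_on_subset)
  ultimately have "card S \<le> card S'"
    by (intro card_inj_on_le) (auto simp: S_def)
  moreover have "embedding \<psi> (pair_del_verts H S) (pair_del_verts H' S')"
    using \<psi> by (auto simp: embedding_def pair_del_verts_def S_def intro: inj_on_subset)
  then have "\<not> contains_family_graph (with_proj (pair_del_verts H S)) \<F>"
    using none H H' contains_family_graph_mono pair_graph_imp_wf pair_graph_pair_del_verts by metis
  ultimately show thesis
    using that[of S] S' by (auto simp: S_def del_verts_with_proj)
qed

section \<open>Isolating sets\<close>

lemma iota_le_card: "isolating G \<F> D \<Longrightarrow> iota G \<F> \<le> card D"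
  unfolding iota_def by (blast intro: Least_le)

lemma iota_attained:
  assumes "isolating G \<F> D"
  obtains D' where "isolating G \<F> D'" "card D' = iota G \<F>"
proof -
  have "\<exists>D'. isolating G \<F> D' \<and> card D' = iota G \<F>"
    unfolding iota_def by (rule LeastI_ex) (use assms in blast)
  then show thesis using that by blast
qed

text \<open>
  Existence of some isolating set is what makes the least element in the definition of \<open>iota\<close> a
  genuine minimum; otherwise \<open>iota\<close> would be an unspecified number.
\<close>

lemma isolating_all_verts:
  assumes G: "pair_graph G" and nonnull: "\<forall>M\<in>\<F>. nonnull_graph M"
  shows "isolating G \<F> (pverts G)"
proof -
  have "\<not> contains_family_graph (with_proj (pair_del_verts G (closed_nbhd G (pverts G)))) \<F>"
    using assms
    by (intro not_contains_family_graph_null pair_graph_imp_wf pair_graph_pair_del_verts)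
      (auto simp: pair_del_verts_def closed_nbhd_def)
  then show ?thesis by (simp add: isolating_def del_verts_with_proj)
qed

lemma copies_member_contains:
  assumes "M \<in> copies t \<F>" "t \<ge> 1" "pair_wf_digraph M"
  shows "contains_family_graph (with_proj M) \<F>"
proof -
  obtain Fs where
    M: "M = \<lparr>pverts = (\<Union>i\<in>{1..t}. pverts (Fs i)), parcs = (\<Union>i\<in>{1..t}. parcs (Fs i))\<rparr>"
    and Fs: "\<forall>i\<in>{1..t}. family_graph \<F> (with_proj (Fs i))"
    using assms(1) unfolding copies_def by blast
  have 1: "1 \<in> {1..t}" using assms(2) by simp
  obtain A h where "A \<in> \<F>" "pre_digraph.digraph_isomorphism (with_proj A) h"
    and F1: "with_proj (Fs 1) = app_iso h (with_proj A)"
    using Fs 1 unfolding family_graph_def digraph_iso_def by blast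
  then have "wf_digraph (with_proj (Fs 1))"
    by (metis wf_digraph.wf_digraphI_app_iso pre_digraph.digraph_isomorphism_def)
  moreover have "pverts (Fs 1) \<subseteq> pverts M" "parcs (Fs 1) \<subseteq> parcs M"
    using 1 by (auto simp: M)
  ultimately have "subgraph (with_proj (Fs 1)) (with_proj M)"
    using assms(3) by (simp add: subgraph_def compatible_def wf_digraph_wp_iff)
  then show ?thesis
    using Fs 1 unfolding contains_family_graph_def by blast
qed

lemma isolating_copies:
  assumes "pair_graph G" "t \<ge> 1" "isolating G \<F> D"
  shows "isolating G (copies t \<F>) D"
proof -
  let ?H = "pair_del_verts G (closed_nbhd G D)"
  have wf: "pair_wf_digraph ?H"
    using assms(1) pair_graph_imp_wf pair_graph_pair_del_verts by blast
  have "contains_family_graph (with_proj ?H) \<F>"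
    if "contains_family_graph (with_proj ?H) (copies t \<F>)"
    using that assms(2) wf copies_member_contains contains_family_graph_mono
      contains_family_graph_iff[OF wf] by metis
  then show ?thesis
    using assms(3) by (auto simp: isolating_def del_verts_with_proj)
qed

text \<open>
  Deleting \<open>N[D \<union> S]\<close> removes at least the vertices removed by deleting \<open>N[D]\<close> and then \<open>S\<close>, and
  what remains after the second deletion contains no member of the family.
\<close>

lemma isolating_Un:
  assumes G: "pair_graph G" and "D \<subseteq> pverts G"
    and S: "S \<subseteq> pverts (pair_del_verts G (closed_nbhd G D))"
    and none: "\<not> contains_family_graph
      (del_verts (with_proj (pair_del_verts G (closed_nbhd G D))) S) \<F>"
  shows "isolating G \<F> (D \<union> S)"
proof -
  have "embedding id (pair_del_verts G (closed_nbhd G (D \<union> S)))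
      (pair_del_verts (pair_del_verts G (closed_nbhd G D)) S)"
    by (auto simp: embedding_def pair_del_verts_def closed_nbhd_def)
  then have "\<not> contains_family_graph (with_proj (pair_del_verts G (closed_nbhd G (D \<union> S)))) \<F>"
    using none G contains_family_graph_mono pair_graph_imp_wf pair_graph_pair_del_verts
    unfolding del_verts_with_proj by metis
  moreover have "S \<subseteq> pverts G"
    using S by (auto simp: pair_del_verts_def)
  ultimately show ?thesis
    using \<open>D \<subseteq> pverts G\<close> by (simp add: isolating_def del_verts_with_proj)
qed

theorem theorem7:
  fixes t :: nat
    and G :: "'v pair_pre_digraph"
    and \<F> :: "'u::infinite pair_pre_digraph set"
    and f :: "nat \<Rightarrow> nat"
  assumes "t \<ge> 1"
    and "nonnull_graph G"
    and "\<forall>M\<in>\<F>. nonnull_graph M"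
    and "EP_property \<F> f"
  shows "int (iota G \<F>) - int (f t) \<le> int (iota G (copies t \<F>))
    \<and> iota G (copies t \<F>) \<le> iota G \<F>"
proof -
  have G: "pair_graph G" using assms(2) by (simp add: nonnull_graph_def)
  obtain D0 where D0: "isolating G \<F> D0" "card D0 = iota G \<F>"
    using iota_attained[OF isolating_all_verts[OF G assms(3)]] .
  have D0': "isolating G (copies t \<F>) D0"
    using isolating_copies[OF G assms(1) D0(1)] .
  then have upper: "iota G (copies t \<F>) \<le> iota G \<F>"
    using iota_le_card D0(2) by metis
  obtain D where D: "isolating G (copies t \<F>) D" "card D = iota G (copies t \<F>)"
    using iota_attained[OF D0'] .
  let ?H = "pair_del_verts G (closed_nbhd G D)"
  have "\<not> contains_family_graph (with_proj ?H) (copies t \<F>)"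
    using D(1) by (simp add: isolating_def del_verts_with_proj)
  then obtain S where "S \<subseteq> pverts ?H" "card S \<le> f t"
    "\<not> contains_family_graph (del_verts (with_proj ?H) S) \<F>"
    by (rule EP_property_hitting_set[OF assms(4,1,3) pair_graph_pair_del_verts[OF G]])
  moreover from this have "isolating G \<F> (D \<union> S)"
    using D(1) by (intro isolating_Un[OF G]) (simp_all add: isolating_def)
  then have "iota G \<F> \<le> card (D \<union> S)" by (rule iota_le_card)
  ultimately have "iota G \<F> \<le> iota G (copies t \<F>) + f t"
    using card_Un_le[of D S] D(2) by linarith
  with upper show ?thesis by linarith
qed

end
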